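(* Let $\mathbb{k}$ be an algebraically closed field and let $p,q\in\mathbb{k}^*$ with $pq\neq1$ be roots of unity. Let $\lambda,\lambda'\in\mathbb{k}^*$. Then $\mathcal{V}_3(\lambda)\cong\mathcal{V}_3(\lambda')$ as right $\mathcal{H}_{p,q}$-modules if and only if $\lambda=\lambda'$.
   Context: For $p,q\in\mathbb{k}^*=\mathbb{k}\setminus\{0\}$, $\mathcal{H}_{p,q}$ is the $\mathbb{k}$-algebra generated by $x,y,z$ subject to the relations $zx=p^{-1}xz$, $zy=pyz$, $yx-qxy=z$. All modules are right modules. Put $[k]_{p,q}:=\frac{q^k-p^{-k}}{q-p^{-1}}=\sum_{i=0}^{k-1}q^ip^{-(k-1-i)}$. With $N=\operatorname{ord}(pq)$ the multiplicative order of $pq$, $\mathcal{V}_3(\lambda)$ is the $\mathbb{k}$-vector space with basis $\{v_k\mid0\le k\le N-1\}$ and right $\mathcal{H}_{p,q}$-module structure given by: $v_kz=p^{-k}\lambda v_k$; $v_ky=v_{k+1}$ for $0\le k\le N-2$ and $v_{N-1}y=0$; $v_kx=\lambda[k]_{p,q}v_{k-1}$ for $1\le k\le N-1$ and $v_0x=0$. *)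

theory Defs
  imports
    "HOL-Library.Poly_Mapping"
    "HOL-Algebra.QuotRing"
    "HOL-Algebra.Multiplicative_Group"
    "HOL-Algebra.Algebraic_Closure_Type"
begin

section \<open>Right modules\<close>

text \<open>
  The locale \<open>module\<close> of HOL-Algebra only covers commutative rings. As there, the underlying
  abelian group is carried by a \<open>ring\<close> record whose multiplicative part is not used.
\<close>

record ('r, 'm) rmodule = "'m ring" +
  ract :: "'m \<Rightarrow> 'r \<Rightarrow> 'm"  (infixl \<open>\<lhd>\<index>\<close> 70)

locale right_module = R: ring R + M: abelian_group M
  for R :: "('r, 'a) ring_scheme" (structure) and M :: "('r, 'm, 'b) rmodule_scheme" (structure) +
  assumes ract_closed: "\<lbrakk>v \<in> carrier M; a \<in> carrier R\<rbrakk> \<Longrightarrow> v \<lhd>\<^bsub>M\<^esub> a \<in> carrier M"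
    and ract_add_left: "\<lbrakk>v \<in> carrier M; w \<in> carrier M; a \<in> carrier R\<rbrakk>
          \<Longrightarrow> (v \<oplus>\<^bsub>M\<^esub> w) \<lhd>\<^bsub>M\<^esub> a = (v \<lhd>\<^bsub>M\<^esub> a) \<oplus>\<^bsub>M\<^esub> (w \<lhd>\<^bsub>M\<^esub> a)"
    and ract_add_right: "\<lbrakk>v \<in> carrier M; a \<in> carrier R; b \<in> carrier R\<rbrakk>
          \<Longrightarrow> v \<lhd>\<^bsub>M\<^esub> (a \<oplus>\<^bsub>R\<^esub> b) = (v \<lhd>\<^bsub>M\<^esub> a) \<oplus>\<^bsub>M\<^esub> (v \<lhd>\<^bsub>M\<^esub> b)"
    and ract_mult: "\<lbrakk>v \<in> carrier M; a \<in> carrier R; b \<in> carrier R\<rbrakk>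
          \<Longrightarrow> v \<lhd>\<^bsub>M\<^esub> (a \<otimes>\<^bsub>R\<^esub> b) = (v \<lhd>\<^bsub>M\<^esub> a) \<lhd>\<^bsub>M\<^esub> b"
    and ract_one: "v \<in> carrier M \<Longrightarrow> v \<lhd>\<^bsub>M\<^esub> \<one>\<^bsub>R\<^esub> = v"

definition rmodule_hom ::
    "('r, 'a) ring_scheme \<Rightarrow> ('r, 'm, 'b) rmodule_scheme \<Rightarrow> ('r, 'n, 'c) rmodule_scheme \<Rightarrow> ('m \<Rightarrow> 'n) set"
  where "rmodule_hom R M N = {f \<in> carrier M \<rightarrow> carrier N.
     (\<forall>v\<in>carrier M. \<forall>w\<in>carrier M. f (v \<oplus>\<^bsub>M\<^esub> w) = f v \<oplus>\<^bsub>N\<^esub> f w) \<and>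
     (\<forall>v\<in>carrier M. \<forall>a\<in>carrier R. f (v \<lhd>\<^bsub>M\<^esub> a) = f v \<lhd>\<^bsub>N\<^esub> a)}"

definition rmodule_isomorphic ::
    "('r, 'a) ring_scheme \<Rightarrow> ('r, 'm, 'b) rmodule_scheme \<Rightarrow> ('r, 'n, 'c) rmodule_scheme \<Rightarrow> bool"
  where "rmodule_isomorphic R M N \<longleftrightarrow>
     (\<exists>f \<in> rmodule_hom R M N. bij_betw f (carrier M) (carrier N))"


section \<open>The algebra generated by x, y, z\<close>

text \<open>
  The free algebra on a set of letters is the monoid algebra of the free monoid of words; the
  type \<open>poly_mapping\<close> writes the monoid of exponents additively, so that concatenation is \<open>+\<close>.
\<close>

datatype 'g fword = Word (letters: "'g list")

instantiation fword :: (type) monoid_add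
begin
definition "0 = Word []"
definition "u + v = Word (letters u @ letters v)"
instance by standard (auto simp: zero_fword_def plus_fword_def)
end

datatype hgen = GX | GY | GZ

type_synonym 'k free_xyz = "hgen fword \<Rightarrow>\<^sub>0 'k"

definition gvar :: "hgen \<Rightarrow> 'k::field free_xyz"
  where "gvar g = Poly_Mapping.single (Word [g]) 1"

definition scal :: "'k::field \<Rightarrow> 'k free_xyz"
  where "scal c = Poly_Mapping.single 0 c"

definition H_relators :: "'k::field \<Rightarrow> 'k \<Rightarrow> 'k free_xyz set"
  where "H_relators p q =
    {gvar GZ * gvar GX - scal (inverse p) * (gvar GX * gvar GZ),
     gvar GZ * gvar GY - scal p * (gvar GY * gvar GZ),
     gvar GY * gvar GX - scal q * (gvar GX * gvar GY) - gvar GZ}"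

abbreviation free_ring :: "'k::field free_xyz ring"
  where "free_ring \<equiv> ring_of_type_algebra"

definition H_ideal :: "'k::field \<Rightarrow> 'k \<Rightarrow> 'k free_xyz set"
  where "H_ideal p q = Idl\<^bsub>free_ring\<^esub> (H_relators p q)"

definition H_alg :: "'k::field \<Rightarrow> 'k \<Rightarrow> 'k free_xyz set ring"
  where "H_alg p q = free_ring Quot H_ideal p q"

definition H_class :: "'k::field \<Rightarrow> 'k \<Rightarrow> 'k free_xyz \<Rightarrow> 'k free_xyz set"
  where "H_class p q a = H_ideal p q +>\<^bsub>free_ring\<^esub> a"


section \<open>The modules \<open>V\<^sub>3\<close>\<close>

definition mult_ord :: "'k::field \<Rightarrow> nat"
  where "mult_ord a = group.ord (units_of (ring_of_type_algebra :: 'k ring)) a"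

definition pq_number :: "'k::field \<Rightarrow> 'k \<Rightarrow> nat \<Rightarrow> 'k"
  where "pq_number p q k = (q ^ k - inverse p ^ k) / (q - inverse p)"

text \<open>
  A vector is its coordinate function with respect to the basis \<open>v\<^sub>0, \<dots>, v\<^bsub>N-1\<^esub>\<close>.
\<close>

definition bvec :: "nat \<Rightarrow> nat \<Rightarrow> 'k::field"
  where "bvec k = (\<lambda>j. if j = k then 1 else 0)"

fun V3_basis_act :: "'k::field \<Rightarrow> 'k \<Rightarrow> 'k \<Rightarrow> hgen \<Rightarrow> nat \<Rightarrow> nat \<Rightarrow> 'k" where
  "V3_basis_act p q l GZ k = (\<lambda>j. inverse p ^ k * l * bvec k j)"
| "V3_basis_act p q l GY k = (if k + 1 < mult_ord (p * q) then bvec (k + 1) else (\<lambda>j. 0))"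
| "V3_basis_act p q l GX k = (if k = 0 then (\<lambda>j. 0) else (\<lambda>j. l * pq_number p q k * bvec (k - 1) j))"

definition V3_gen_act :: "'k::field \<Rightarrow> 'k \<Rightarrow> 'k \<Rightarrow> hgen \<Rightarrow> (nat \<Rightarrow> 'k) \<Rightarrow> nat \<Rightarrow> 'k"
  where "V3_gen_act p q l g v = (\<lambda>j. \<Sum>k<mult_ord (p * q). v k * V3_basis_act p q l g k j)"

text \<open>
  For a right action the letters of a word operate from left to right.
\<close>

definition word_act :: "(hgen \<Rightarrow> (nat \<Rightarrow> 'k) \<Rightarrow> (nat \<Rightarrow> 'k)) \<Rightarrow> hgen fword \<Rightarrow> (nat \<Rightarrow> 'k) \<Rightarrow> nat \<Rightarrow> 'k"
  where "word_act A w v = foldl (\<lambda>u g. A g u) v (letters w)"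

definition free_act ::
    "(hgen \<Rightarrow> (nat \<Rightarrow> 'k::field) \<Rightarrow> (nat \<Rightarrow> 'k)) \<Rightarrow> (nat \<Rightarrow> 'k) \<Rightarrow> 'k free_xyz \<Rightarrow> nat \<Rightarrow> 'k"
  where "free_act A v a =
    (\<lambda>j. \<Sum>w\<in>Poly_Mapping.keys a. Poly_Mapping.lookup a w * word_act A w v j)"

text \<open>
  A residue class acts through any of its representatives; that the choice does not matter is
  \<open>V3_ract_class\<close> below.
\<close>

definition V3 :: "'k::field \<Rightarrow> 'k \<Rightarrow> 'k \<Rightarrow> ('k free_xyz set, nat \<Rightarrow> 'k) rmodule"
  where "V3 p q l =
    \<lparr>carrier = {v. \<forall>j\<ge>mult_ord (p * q). v j = 0},
     monoid.mult = undefined, one = undefined,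
     ring.zero = (\<lambda>j. 0), add = (\<lambda>v w j. v j + w j),
     ract = (\<lambda>v h. free_act (V3_gen_act p q l) v (SOME a. a \<in> h))\<rparr>"

definition root_of_unity :: "'k::field \<Rightarrow> bool"
  where "root_of_unity a \<longleftrightarrow> (\<exists>n>0. a ^ n = 1)"


section \<open>The definitions are meaningful\<close>

lemma ring_of_ring_1: "ring (ring_of_type_algebra :: 'a::ring_1 ring)"
proof -
  have "\<exists>y. x + y = 0" for x :: 'a
    using add.right_inverse by blast
  thus ?thesis
    unfolding ring_of_type_algebra_def using add.right_inverse
    by unfold_locales (auto simp: algebra_simps Units_def)
qed

lemma ring_of_type_algebra_simps [simp]:
  "carrier ring_of_type_algebra = UNIV" "a \<otimes>\<^bsub>ring_of_type_algebra\<^esub> b = a * b"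
  "a \<oplus>\<^bsub>ring_of_type_algebra\<^esub> b = a + b" "\<one>\<^bsub>ring_of_type_algebra\<^esub> = 1" "\<zero>\<^bsub>ring_of_type_algebra\<^esub> = 0"
  by (simp_all add: ring_of_type_algebra_def)

lemma ideal_H_ideal: "ideal (H_ideal p q) free_ring"
  unfolding H_ideal_def by (rule ring.genideal_ideal[OF ring_of_ring_1]) simp

lemma ring_H_alg: "ring (H_alg p q)"
  unfolding H_alg_def by (rule ideal.quotient_is_ring[OF ideal_H_ideal])

lemma H_class_def': "H_class p q a = {i + a |i. i \<in> H_ideal p q}"
  by (auto simp: H_class_def a_r_coset_def r_coset_def)

lemma carrier_H_alg: "carrier (H_alg p q) = range (H_class p q)"
  by (auto simp: H_alg_def FactRing_def A_RCOSETS_def RCOSETS_def H_class_def a_r_coset_def)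

lemma H_class_mult: "H_class p q a \<otimes>\<^bsub>H_alg p q\<^esub> H_class p q b = H_class p q (a * b)"
  using ideal.rcoset_mult_add[OF ideal_H_ideal, of a b]
  by (simp add: H_alg_def FactRing_def H_class_def)

lemma H_class_add: "H_class p q a \<oplus>\<^bsub>H_alg p q\<^esub> H_class p q b = H_class p q (a + b)"
  using abelian_subgroup.a_rcos_sum[of "H_ideal p q" free_ring a b] ideal_H_ideal[of p q]
  by (simp add: H_alg_def FactRing_def H_class_def ideal_def abelian_subgroupI3 ideal.axioms(1)
      ring.is_abelian_group)

lemma H_class_one: "\<one>\<^bsub>H_alg p q\<^esub> = H_class p q 1"
  by (simp add: H_alg_def FactRing_def H_class_def)

lemma mult_ord_dvd: "a ^ n = 1 \<longleftrightarrow> mult_ord a dvd n" if "a \<noteq> 0" for a :: "'k::field"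
proof -
  let ?G = "units_of (ring_of_type_algebra :: 'k ring)"
  interpret R: Ring.field "ring_of_type_algebra :: 'k ring" by (rule field_from_type_algebra)
  interpret G: Group.group ?G by (rule R.units_group)
  have "a [^]\<^bsub>?G\<^esub> n = a ^ n"
    by (induction n) (simp_all add: units_of_def nat_pow_def mult.commute)
  moreover have "a \<in> carrier ?G"
    using that by (simp add: units_of_def R.field_Units)
  ultimately show ?thesis
    using G.pow_eq_id[of a n] by (simp add: mult_ord_def units_of_def)
qed

lemma mult_ord_pos:
  fixes p q :: "'k::field"
  assumes pq: "root_of_unity p" "root_of_unity q" "p \<noteq> 0" "q \<noteq> 0"
  shows "mult_ord (p * q) > 0"
proof -
  obtain m n where "m > 0" "n > 0" "p ^ m = 1" "q ^ n = 1"
    using pq by (auto simp: root_of_unity_def)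
  have "(p * q) ^ (m * n) = (p ^ m) ^ n * (q ^ n) ^ m"
    unfolding power_mult[symmetric] mult.commute[of n m] by (rule power_mult_distrib)
  also have "\<dots> = 1"
    using \<open>p ^ m = 1\<close> \<open>q ^ n = 1\<close> by simp
  finally have "mult_ord (p * q) dvd m * n"
    using pq mult_ord_dvd[of "p * q" "m * n"] by simp
  with \<open>m > 0\<close> \<open>n > 0\<close> show ?thesis by (auto intro: Nat.gr0I)
qed

definition linop :: "((nat \<Rightarrow> 'k::field) \<Rightarrow> nat \<Rightarrow> 'k) \<Rightarrow> bool"
  where "linop F \<longleftrightarrow> (\<forall>u v. F (\<lambda>j. u j + v j) = (\<lambda>j. F u j + F v j)) \<and>
    (\<forall>c u. F (\<lambda>j. c * u j) = (\<lambda>j. c * F u j))"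

lemma linop_zero: "F (\<lambda>j. 0) = (\<lambda>j. 0)" if "linop F"
proof -
  have "\<forall>c u. F (\<lambda>j. c * u j) = (\<lambda>j. c * F u j)"
    using that by (simp add: linop_def)
  from this[rule_format, of 0 "\<lambda>j. 0"] have "F (\<lambda>j. 0) = (\<lambda>j. 0 * F (\<lambda>j. 0) j)"
    by (simp only: mult_zero_left)
  then show ?thesis by simp
qed

lemma linop_sum: "F (\<lambda>j. \<Sum>i\<in>S. c i * u i j) = (\<lambda>j. \<Sum>i\<in>S. c i * F (u i) j)"
  if "linop F" "finite S"
  using that(2)
proof (induction S rule: finite_induct)
  case empty
  then show ?case using linop_zero[OF that(1)] by simp
next
  case (insert i S)
  then show ?case using that(1) by (simp add: linop_def)
qed

lemma linop_word_act: "(\<And>g. linop (A g)) \<Longrightarrow> linop (word_act A w)"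
proof -
  assume A: "\<And>g. linop (A g)"
  have "linop (\<lambda>v. foldl (\<lambda>u g. A g u) v gs)" for gs
  proof (induction gs)
    case Nil
    then show ?case by (simp add: linop_def)
  next
    case (Cons g gs)
    then show ?case using A[of g] by (simp add: linop_def)
  qed
  then show ?thesis by (simp add: word_act_def[abs_def])
qed

lemma word_act_add: "word_act A (u + w) v = word_act A w (word_act A u v)"
  by (simp add: word_act_def plus_fword_def)

lemma word_act_zero: "word_act A 0 v = v"
  by (simp add: word_act_def zero_fword_def)

lemma free_act_superset:
  "finite S \<Longrightarrow> Poly_Mapping.keys a \<subseteq> S \<Longrightarrow>
   free_act A v a j = (\<Sum>w\<in>S. Poly_Mapping.lookup a w * word_act A w v j)"
  unfolding free_act_def by (rule sum.mono_neutral_left) (auto simp: in_keys_iff)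

lemma free_act_add: "free_act A v (a + b) = (\<lambda>j. free_act A v a j + free_act A v b j)"
proof
  fix j
  let ?S = "Poly_Mapping.keys a \<union> Poly_Mapping.keys b"
  have "Poly_Mapping.keys (a + b) \<subseteq> ?S" by (rule Poly_Mapping.keys_add)
  then show "free_act A v (a + b) j = free_act A v a j + free_act A v b j"
    by (simp add: free_act_superset[of ?S] lookup_add sum.distrib algebra_simps)
qed

lemma free_act_zero: "free_act A v 0 = (\<lambda>j. 0)"
  by (simp add: free_act_def)

lemma free_act_minus: "free_act A v (a - b) = (\<lambda>j. free_act A v a j - free_act A v b j)"
  using free_act_add[of A v "a - b" b] by (simp add: fun_eq_iff)

lemma free_act_sum: "free_act A v (sum f S) j = (\<Sum>i\<in>S. free_act A v (f i) j)"
  by (induction S rule: infinite_finite_induct) (simp_all add: free_act_add free_act_zero)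

lemma free_act_single: "free_act A v (Poly_Mapping.single w c) = (\<lambda>j. c * word_act A w v j)"
  by (cases "c = 0") (simp_all add: free_act_def)

lemma free_act_scal: "free_act A v (scal c) = (\<lambda>j. c * v j)"
  by (simp add: scal_def free_act_single word_act_zero)

lemma free_act_one: "free_act A v 1 = v"
  using free_act_scal[of A v 1] by (simp add: scal_def)

lemma free_act_var: "free_act A v (gvar g) = A g v"
  by (simp add: gvar_def free_act_single word_act_def)

lemma poly_mapping_expand:
  "a = (\<Sum>w\<in>Poly_Mapping.keys a. Poly_Mapping.single w (Poly_Mapping.lookup a w))"
  by (rule poly_mapping_eqI) (auto simp: lookup_sum lookup_single when_def in_keys_iff)

lemma free_act_mult:
  assumes A: "\<And>g. linop (A g)"
  shows "free_act A v (a * b) = free_act A (free_act A v a) b"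
proof
  fix j
  let ?K = "Poly_Mapping.keys" and ?L = "Poly_Mapping.lookup"
  have "a * b = (\<Sum>w\<in>?K a. Poly_Mapping.single w (?L a w))
      * (\<Sum>u\<in>?K b. Poly_Mapping.single u (?L b u))"
    by (simp only: poly_mapping_expand[symmetric])
  also have "\<dots> = (\<Sum>w\<in>?K a. \<Sum>u\<in>?K b. Poly_Mapping.single (w + u) (?L a w * ?L b u))"
    by (simp only: sum_product mult_single)
  finally have "free_act A v (a * b) j
      = (\<Sum>w\<in>?K a. \<Sum>u\<in>?K b. (?L a w * ?L b u) * word_act A u (word_act A w v) j)"
    by (simp add: free_act_sum free_act_single word_act_add)
  also have "\<dots> = (\<Sum>u\<in>?K b. ?L b u * (\<Sum>w\<in>?K a. ?L a w * word_act A u (word_act A w v) j))"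
    unfolding sum_distrib_left by (subst sum.swap, intro sum.cong refl) (simp only: mult_ac)
  also have "\<dots> = (\<Sum>u\<in>?K b. ?L b u * word_act A u (free_act A v a) j)"
    unfolding free_act_def[of A v a] by (simp only: linop_sum[OF linop_word_act[OF A] finite_keys])
  finally show "free_act A v (a * b) j = free_act A (free_act A v a) b j"
    by (simp add: free_act_def[of A "free_act A v a" b])
qed

lemma linop_free_act: "(\<And>g. linop (A g)) \<Longrightarrow> linop (\<lambda>v. free_act A v a)"
  using linop_word_act[of A]
  by (auto simp: linop_def free_act_def sum.distrib sum_distrib_left algebra_simps)

lemma linop_V3_gen_act: "linop (V3_gen_act p q l g)"
  by (auto simp: linop_def V3_gen_act_def sum.distrib sum_distrib_left algebra_simps)

lemma V3_gen_act_bvec: "k < mult_ord (p * q) \<Longrightarrow> V3_gen_act p q l g (bvec k) = V3_basis_act p q l g k"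
  by (simp add: V3_gen_act_def bvec_def if_distrib[of "\<lambda>x. x * _"] cong: if_cong)

lemma V3_basis_act_closed:
  "k < mult_ord (p * q) \<Longrightarrow> j \<ge> mult_ord (p * q) \<Longrightarrow> V3_basis_act p q l g k j = 0"
  by (cases g) (auto simp: bvec_def)

lemma V3_gen_act_closed: "V3_gen_act p q l g v \<in> carrier (V3 p q l)"
  by (auto simp: V3_def V3_gen_act_def V3_basis_act_closed)

lemma V3_word_act_closed: "v \<in> carrier (V3 p q l) \<Longrightarrow> word_act (V3_gen_act p q l) w v \<in> carrier (V3 p q l)"
proof -
  have "v \<in> carrier (V3 p q l) \<Longrightarrow>
      foldl (\<lambda>u g. V3_gen_act p q l g u) v gs \<in> carrier (V3 p q l)" for gs
    by (induction gs arbitrary: v) (simp_all add: V3_gen_act_closed)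
  then show "v \<in> carrier (V3 p q l) \<Longrightarrow> ?thesis" by (simp add: word_act_def)
qed

lemma V3_free_act_closed: "v \<in> carrier (V3 p q l) \<Longrightarrow> free_act (V3_gen_act p q l) v a \<in> carrier (V3 p q l)"
  using V3_word_act_closed[of v p q l] by (simp add: free_act_def V3_def)

lemma V3_expand:
  "v \<in> carrier (V3 p q l) \<Longrightarrow> v = (\<lambda>j. \<Sum>k<mult_ord (p * q). v k * bvec k j)"
  by (auto simp: V3_def bvec_def fun_eq_iff not_less if_distrib[of "\<lambda>x. _ * x"] cong: if_cong)

lemma free_act_eq_zero:
  assumes "v \<in> carrier (V3 p q l)"
    and "\<And>k. k < mult_ord (p * q) \<Longrightarrow> free_act (V3_gen_act p q l) (bvec k) a = (\<lambda>j. 0)"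
  shows "free_act (V3_gen_act p q l) v a = (\<lambda>j. 0)"
proof -
  have "free_act (V3_gen_act p q l) v a
      = (\<lambda>j. \<Sum>k<mult_ord (p * q). v k * free_act (V3_gen_act p q l) (bvec k) a j)"
    by (subst V3_expand[OF assms(1)])
      (rule linop_sum[OF linop_free_act[OF linop_V3_gen_act]], simp)
  then show ?thesis using assms(2) by simp
qed

lemma pq_number_Suc:
  assumes "p \<noteq> 0" "p * q \<noteq> (1::'k::field)"
  shows "pq_number p q (Suc k) = q * pq_number p q k + inverse p ^ k"
proof -
  have "q - inverse p \<noteq> 0" using assms by (auto simp: field_simps)
  moreover have "q ^ Suc k - inverse p ^ Suc k
      = q * (q ^ k - inverse p ^ k) + inverse p ^ k * (q - inverse p)"
    by (simp add: algebra_simps)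
  ultimately show ?thesis by (simp add: pq_number_def add_divide_distrib)
qed

lemma pq_number_eq_0_iff:
  assumes "p \<noteq> 0" "q \<noteq> 0" "p * q \<noteq> (1::'k::field)"
  shows "pq_number p q k = 0 \<longleftrightarrow> mult_ord (p * q) dvd k"
proof -
  have "q - inverse p \<noteq> 0" using assms by (auto simp: field_simps)
  then have "pq_number p q k = 0 \<longleftrightarrow> q ^ k = inverse p ^ k"
    by (simp add: pq_number_def)
  also have "\<dots> \<longleftrightarrow> (p * q) ^ k = 1"
    using assms by (simp add: power_mult_distrib power_inverse field_simps)
  finally have "pq_number p q k = 0 \<longleftrightarrow> (p * q) ^ k = 1" .
  then show ?thesis using assms mult_ord_dvd[of "p * q" k] by simp
qed

lemma V3_relators:
  fixes p q l :: "'k::field"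
  assumes pq: "p \<noteq> 0" "q \<noteq> 0" "p * q \<noteq> 1"
    and v: "v \<in> carrier (V3 p q l)" and r: "r \<in> H_relators p q"
  shows "free_act (V3_gen_act p q l) v r = (\<lambda>j. 0)"
proof (rule free_act_eq_zero[OF v])
  let ?N = "mult_ord (p * q)" and ?A = "V3_gen_act p q l"
  fix k assume k: "k < ?N"
  note lin = linop_V3_gen_act[of p q l]
  have scale: "?A g (\<lambda>j. c * u j) = (\<lambda>j. c * ?A g u j)" for g c u
    using lin[of g] by (simp add: linop_def)
  have zero: "?A g (\<lambda>j. 0) = (\<lambda>j. 0)" for g
    by (rule linop_zero[OF lin])
  note simps = free_act_mult[OF lin] free_act_scal free_act_var free_act_minus V3_gen_act_bvec[OF k]
    scale zero V3_gen_act_bvec fun_eq_iff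
  consider "r = gvar GZ * gvar GX - scal (inverse p) * (gvar GX * gvar GZ)"
    | "r = gvar GZ * gvar GY - scal p * (gvar GY * gvar GZ)"
    | "r = gvar GY * gvar GX - scal q * (gvar GX * gvar GY) - gvar GZ"
    using r by (auto simp: H_relators_def)
  then show "free_act ?A (bvec k) r = (\<lambda>j. 0)"
  proof cases
    case 1
    show ?thesis
    proof (cases k)
      case 0
      then show ?thesis using k by (simp add: 1 simps)
    next
      case (Suc m)
      then have "m < ?N" using k by simp
      then show ?thesis using k Suc by (simp add: 1 simps)
    qed
  next
    case 2
    show ?thesis using k pq by (cases "k + 1 < ?N") (simp_all add: 2 simps)
  next
    case 3
    have top: "pq_number p q (Suc k) = 0" if "\<not> Suc k < ?N"
      using that k pq pq_number_eq_0_iff[of p q "Suc k"] by (auto dest: Suc_lessI)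
    have S: "pq_number p q (Suc k) = q * pq_number p q k + inverse p ^ k"
      by (rule pq_number_Suc) (use pq in auto)
    show ?thesis
    proof (cases k)
      case 0
      have "pq_number p q 0 = 0" by (simp add: pq_number_def)
      with S 0 have one: "pq_number p q (Suc 0) = 1" by simp
      then have "Suc 0 < ?N" using top 0 by force
      then show ?thesis using k one 0 by (simp add: 3 simps)
    next
      case (Suc m)
      then have m: "m < ?N" "Suc m < ?N" using k by simp_all
      show ?thesis
      proof (cases "Suc k < ?N")
        case True
        then show ?thesis using k m Suc S by (simp add: 3 simps) (simp add: algebra_simps)
      next
        case False
        then have "0 = q * pq_number p q k + inverse p ^ k" using top S by simp
        then have "inverse p ^ k = - (q * pq_number p q k)" by (simp add: eq_neg_iff_add_eq_0 add.commute)
        then show ?thesis using k m Suc False by (simp add: 3 simps)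
      qed
    qed
  qed
qed

lemma V3_ideal:
  fixes p q l :: "'k::field"
  assumes pq: "p \<noteq> 0" "q \<noteq> 0" "p * q \<noteq> 1"
    and v: "v \<in> carrier (V3 p q l)" and a: "a \<in> H_ideal p q"
  shows "free_act (V3_gen_act p q l) v a = (\<lambda>j. 0)"
proof -
  let ?act = "free_act (V3_gen_act p q l)"
  let ?J = "{a :: 'k free_xyz. \<forall>v\<in>carrier (V3 p q l). ?act v a = (\<lambda>j. 0)}"
  note lin = linop_V3_gen_act[of p q l]
  have zero: "?act (\<lambda>j. 0) a = (\<lambda>j. 0)" for a
    by (rule linop_zero[OF linop_free_act[OF lin]])
  have inv: "a_inv free_ring x = - x" for x :: "'k free_xyz"
    using ring_of_ring_1[where 'a = "'k free_xyz"]
    by (intro abelian_group.minus_equality ring.is_abelian_group) simp_all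
  have "ideal ?J (free_ring :: 'k free_xyz ring)"
  proof (rule idealI[OF ring_of_ring_1])
    show "subgroup ?J (add_monoid free_ring)"
    proof (unfold_locales, goal_cases)
      case (4 x)
      then show ?case
        using inv[of x] free_act_minus[of "V3_gen_act p q l" _ 0 x]
        by (simp add: a_inv_def free_act_zero)
    qed (auto simp: free_act_add free_act_zero)
  next
    fix a x assume "a \<in> ?J"
    then show "x \<otimes>\<^bsub>free_ring\<^esub> a \<in> ?J" "a \<otimes>\<^bsub>free_ring\<^esub> x \<in> ?J"
      by (auto simp: free_act_mult[OF lin] V3_free_act_closed zero)
  qed
  moreover have "H_relators p q \<subseteq> ?J"
    using V3_relators[OF pq] by auto
  ultimately have "H_ideal p q \<subseteq> ?J"
    unfolding H_ideal_def by (rule ring.genideal_minimal[OF ring_of_ring_1])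
  then show ?thesis using a v by auto
qed

lemma V3_ract_class:
  fixes p q l :: "'k::field"
  assumes pq: "p \<noteq> 0" "q \<noteq> 0" "p * q \<noteq> 1" and v: "v \<in> carrier (V3 p q l)"
  shows "v \<lhd>\<^bsub>V3 p q l\<^esub> H_class p q a = free_act (V3_gen_act p q l) v a"
proof -
  have "0 \<in> H_ideal p q"
    using additive_subgroup.zero_closed[OF ideal.axioms(1)[OF ideal_H_ideal[of p q]]] by simp
  then have "a \<in> H_class p q a" by (force simp: H_class_def')
  then have "(SOME b. b \<in> H_class p q a) \<in> H_class p q a" by (rule someI)
  then obtain i where "i \<in> H_ideal p q" "(SOME b. b \<in> H_class p q a) = i + a"
    by (auto simp: H_class_def')
  then show ?thesis using V3_ideal[OF pq v, of i] by (simp add: V3_def free_act_add)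
qed

lemma V3_ract_basis:
  fixes p q l :: "'k::field"
  assumes pq: "p \<noteq> 0" "q \<noteq> 0" "p * q \<noteq> 1" and k: "k < mult_ord (p * q)"
  shows "bvec k \<lhd>\<^bsub>V3 p q l\<^esub> H_class p q (gvar g) = V3_basis_act p q l g k"
proof -
  have "bvec k \<in> carrier (V3 p q l)" using k by (simp add: V3_def bvec_def)
  then show ?thesis
    using k by (simp add: V3_ract_class[OF pq] free_act_var V3_gen_act_bvec)
qed

lemma V3_ract_scal:
  fixes p q l :: "'k::field"
  assumes "p \<noteq> 0" "q \<noteq> 0" "p * q \<noteq> 1" "v \<in> carrier (V3 p q l)"
  shows "v \<lhd>\<^bsub>V3 p q l\<^esub> H_class p q (scal c) = (\<lambda>j. c * v j)"
  by (simp add: V3_ract_class[OF assms] free_act_scal)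

lemma right_module_V3:
  fixes p q l :: "'k::field"
  assumes pq: "p \<noteq> 0" "q \<noteq> 0" "p * q \<noteq> 1"
  shows "right_module (H_alg p q) (V3 p q l)"
proof -
  note lin = linop_V3_gen_act[of p q l]
  have add_closed: "v \<oplus>\<^bsub>V3 p q l\<^esub> w \<in> carrier (V3 p q l)"
    if "v \<in> carrier (V3 p q l)" "w \<in> carrier (V3 p q l)" for v w
    using that by (simp add: V3_def)
  have add: "v \<oplus>\<^bsub>V3 p q l\<^esub> w = (\<lambda>j. v j + w j)" for v w
    by (simp add: V3_def)
  have "abelian_group (V3 p q l)"
  proof (rule abelian_groupI)
    fix v assume "v \<in> carrier (V3 p q l)"
    then show "\<exists>w\<in>carrier (V3 p q l). w \<oplus>\<^bsub>V3 p q l\<^esub> v = \<zero>\<^bsub>V3 p q l\<^esub>"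
      by (intro bexI[of _ "\<lambda>j. - v j"]) (auto simp: V3_def)
  qed (auto simp: V3_def fun_eq_iff)
  moreover have "right_module_axioms (H_alg p q) (V3 p q l)"
  proof (rule right_module_axioms.intro, goal_cases)
    case (1 v a)
    then show ?case by (auto simp: carrier_H_alg V3_ract_class[OF pq] V3_free_act_closed)
  next
    case (2 v w a)
    then show ?case
      using add_closed[OF 2(1,2)] linop_free_act[OF lin]
      by (auto simp: carrier_H_alg V3_ract_class[OF pq] add linop_def)
  next
    case (3 v a b)
    then show ?case
      by (auto simp: carrier_H_alg H_class_add V3_ract_class[OF pq] add free_act_add)
  next
    case (4 v a b)
    then show ?case
      by (auto simp: carrier_H_alg H_class_mult V3_ract_class[OF pq] free_act_mult[OF lin]
          V3_free_act_closed)
  next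
    case (5 v)
    then show ?case by (simp add: H_class_one V3_ract_class[OF pq] free_act_one)
  qed
  ultimately show ?thesis by (intro right_module.intro ring_H_alg)
qed

end

(* A module isomorphism maps v_0, which is killed by x, into the kernel of x on V_3(l'). As
   [k]_{p,q} \<noteq> 0 for 0 < k < N, this kernel is the line spanned by v_0; and z acts on v_0 by
   the scalar l in V_3(l) and by l' in V_3(l'). *)
theory Submission
  imports Defs
begin

text \<open>Only the basis vector with index \<open>Suc j\<close> is sent by x to a multiple of
  \<open>bvec j\<close>, so a single summand survives; the assumption says that this index
  occurs.\<close>

lemma V3_gen_act_GX:
  assumes "Suc j < mult_ord (p * q)"
  shows "V3_gen_act p q l GX v j = v (Suc j) * (l * pq_number p q (Suc j))"
proof -
  have "V3_gen_act p q l GX v j = (\<Sum>k<mult_ord (p * q).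
      if k = Suc j then v (Suc j) * (l * pq_number p q (Suc j)) else 0)"
    unfolding V3_gen_act_def by (rule sum.cong) (auto simp: bvec_def)
  then show ?thesis using assms by simp
qed

text \<open>Coordinate \<open>i\<close> of the image is \<open>v (Suc i)\<close> times a factor that
  is nonzero, because \<open>mult_ord (p * q)\<close> divides no smaller positive number.\<close>

lemma V3_kernel_GX:
  fixes p q l :: "'k::field"
  assumes pq: "p \<noteq> 0" "q \<noteq> 0" "p * q \<noteq> 1" and "l \<noteq> 0"
    and v: "v \<in> carrier (V3 p q l)" and x: "V3_gen_act p q l GX v = (\<lambda>j. 0)"
  shows "v = (\<lambda>j. v 0 * bvec 0 j)"
proof
  fix j
  show "v j = v 0 * bvec 0 j"
  proof (cases j)
    case (Suc i)
    have "v (Suc i) = 0"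
    proof (cases "Suc i < mult_ord (p * q)")
      case True
      then have "pq_number p q (Suc i) \<noteq> 0"
        using pq_number_eq_0_iff[OF pq] by (auto dest: dvd_imp_le)
      then show ?thesis
        using V3_gen_act_GX[OF True, of l v] x \<open>l \<noteq> 0\<close> by simp
    qed (use v in \<open>simp add: V3_def\<close>)
    then show ?thesis using Suc by (simp add: bvec_def)
  qed (simp add: bvec_def)
qed

lemma rmodule_isomorphic_refl: "rmodule_isomorphic R M M"
proof -
  have "id \<in> rmodule_hom R M M" by (auto simp: rmodule_hom_def)
  then show ?thesis unfolding rmodule_isomorphic_def using bij_betw_id by blast
qed

text \<open>The hypothesis \<open>N\<close> excludes infinite order, where \<open>mult_ord\<close>
  is 0 and both modules are zero.\<close>

lemma V3_isomorphic_imp_eq: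
  fixes p q l l' :: "'k::field"
  assumes pq: "p \<noteq> 0" "q \<noteq> 0" "p * q \<noteq> 1"
    and N: "mult_ord (p * q) > 0" and l': "l' \<noteq> 0"
    and iso: "rmodule_isomorphic (H_alg p q) (V3 p q l) (V3 p q l')"
  shows "l = l'"
proof -
  obtain f where hom: "f \<in> rmodule_hom (H_alg p q) (V3 p q l) (V3 p q l')"
    and inj: "inj_on f (carrier (V3 p q l))"
    using iso by (auto simp: rmodule_isomorphic_def bij_betw_def)
  let ?v = "bvec 0 :: nat \<Rightarrow> 'k"
  have v: "?v \<in> carrier (V3 p q l)" using N by (simp add: V3_def bvec_def)
  have fv: "f ?v \<in> carrier (V3 p q l')" using hom v by (auto simp: rmodule_hom_def)
  \<comment> \<open>Passing from classes to representatives lets \<open>f\<close> be tested on the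
    generators and on scalars.\<close>
  have act: "f (free_act (V3_gen_act p q l) ?v a) = free_act (V3_gen_act p q l') (f ?v) a" for a
    using hom v
    by (simp add: rmodule_hom_def carrier_H_alg V3_ract_class[OF pq, symmetric] fv)
  \<comment> \<open>Homogeneity is not part of \<open>rmodule_hom\<close>; it follows because
    scalars lie in the algebra.\<close>
  have scal: "f (\<lambda>j. c * ?v j) = (\<lambda>j. c * f ?v j)" for c
    using act[of "scal c"] by (simp only: free_act_scal)
  have zero: "f (\<lambda>j. 0) = (\<lambda>j. 0)"
    using scal[of 0] by simp
  have "V3_gen_act p q l' GX (f ?v) = (\<lambda>j. 0)"
    using act[of "gvar GX"] zero by (simp add: free_act_var V3_gen_act_bvec[OF N])
  then have line: "f ?v = (\<lambda>j. f ?v 0 * ?v j)"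
    by (rule V3_kernel_GX[OF pq l' fv])
  have "f ?v 0 \<noteq> 0"
  proof
    assume "f ?v 0 = 0"
    then have "f ?v = f (\<lambda>j. 0)" using line zero by simp
    then have "?v = (\<lambda>j. 0)" using inj v by (auto simp: V3_def dest!: inj_onD)
    from fun_cong[OF this, of 0] show False by (simp add: bvec_def)
  qed
  \<comment> \<open>The image of v_0 z is computed in both modules and compared at coordinate
    0.\<close>
  moreover have "l * f ?v 0 = l' * f ?v 0"
  proof -
    have "(\<lambda>j. l * f ?v j) = V3_gen_act p q l' GZ (f ?v)"
      using act[of "gvar GZ"] scal[of l] by (simp add: free_act_var V3_gen_act_bvec[OF N])
    also have "\<dots> = V3_gen_act p q l' GZ (\<lambda>j. f ?v 0 * ?v j)"
      using line by (rule arg_cong)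
    also have "\<dots> = (\<lambda>j. f ?v 0 * V3_gen_act p q l' GZ ?v j)"
      using linop_V3_gen_act[of p q l' GZ] unfolding linop_def by blast
    finally have "l * f ?v 0 = f ?v 0 * V3_gen_act p q l' GZ ?v 0" by (rule fun_cong)
    then show ?thesis by (simp add: V3_gen_act_bvec[OF N]) (simp add: bvec_def)
  qed
  ultimately show ?thesis by simp
qed

theorem proposition7p3:
  fixes p q l l' :: "'k::alg_closed_field"
  assumes "p \<noteq> 0" and "q \<noteq> 0" and "p * q \<noteq> 1"
    and "root_of_unity p" and "root_of_unity q"
    and "l \<noteq> 0" and "l' \<noteq> 0"
  shows "rmodule_isomorphic (H_alg p q) (V3 p q l) (V3 p q l') \<longleftrightarrow> l = l'"
  \<comment> \<open>Roots of unity make the order of \<open>p * q\<close> positive; conversely,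
    equal parameters give the same module.\<close>
  using assms V3_isomorphic_imp_eq mult_ord_pos rmodule_isomorphic_refl by metis

end
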